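(* Let $n\ge 1$, let $\mathbb{B}_n$ be the unit ball of $\mathbb{C}^n$, let $P$ be the Bergman projection on $\mathbb{B}_n$, and let $\mathcal{B}$ be the Bloch space of $\mathbb{B}_n$. There exists a function $b\in\mathcal{B}$ such that the commutator $[\bar b,P]$ is not weak-type $(1,1)$. In fact, $b$ can be taken so that $[\bar b,P]$ is not even restricted weak-type $(1,1)$.
   Context: $V$ is Lebesgue measure on $\mathbb{B}_n$ and $|E|=V(E)$. The Bergman projection is $Pf(z)=c_n\int_{\mathbb{B}_n}\frac{f(w)}{(1-\langle z,w\rangle)^{n+1}}\,dV(w)$, $c_n=n!/\pi^n$. The commutator with a symbol $\beta$ is $[\beta,P]f=\beta\,Pf-P(\beta f)$; here $\beta=\bar b$ is the complex conjugate of $b$. The Bloch space is $\mathcal{B}=\{f \text{ holomorphic on }\mathbb{B}_n:\ \sup_{z\in\mathbb{B}_n}|\nabla f(z)|(1-|z|)<\infty\}$, where $\nabla$ is the holomorphic gradient (Bloch functions lie in $L^2(\mathbb{B}_n)$). An operator $T$ is weak-type $(1,1)$ if there is $C>0$ with $|\{z\in\mathbb{B}_n:|Tf(z)|>\lambda\}|\le \frac{C}{\lambda}\|f\|_{L^1(\mathbb{B}_n)}$ for all $\lambda>0$ and all bounded, compactly supported $f$ on $\mathbb{B}_n$. It is restricted weak-type $(1,1)$ if there is $C>0$ with $|\{z\in\mathbb{B}_n:|T\mathbf{1}_A(z)|>\lambda\}|\le \frac{C}{\lambda}|A|$ for all $\lambda>0$ and all measurable $A\subset\mathbb{B}_n$.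 *)

theory Defs
  imports "HOL-Complex_Analysis.Complex_Analysis"
begin

(* Complex n-space is complex ^ 'n, so n = CARD('n) \<ge> 1. Its library norm is the Hermitian norm, so
   ball 0 1 is the unit ball, and its library Lebesgue measure is that of R^(2n). *)

definition herm :: "complex ^ 'n \<Rightarrow> complex ^ 'n \<Rightarrow> complex" where
  "herm z w = (\<Sum>j\<in>UNIV. z $ j * cnj (w $ j))"

definition vol :: "(complex ^ 'n) measure" where
  "vol = lebesgue_on (ball 0 1)"

definition bergman_proj :: "(complex ^ 'n \<Rightarrow> complex) \<Rightarrow> complex ^ 'n \<Rightarrow> complex" where
  "bergman_proj f z = of_real (fact CARD('n) / pi ^ CARD('n)) *
     (LINT w|vol. f w / (1 - herm z w) ^ (CARD('n) + 1))"

definition commutator_proj ::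
  "(complex ^ 'n \<Rightarrow> complex) \<Rightarrow> (complex ^ 'n \<Rightarrow> complex) \<Rightarrow> complex ^ 'n \<Rightarrow> complex" where
  "commutator_proj \<beta> f = (\<lambda>z. \<beta> z * bergman_proj f z - bergman_proj (\<lambda>w. \<beta> w * f w) z)"

definition holomorphic_several :: "(complex ^ 'n \<Rightarrow> complex) \<Rightarrow> (complex ^ 'n) set \<Rightarrow> bool" where
  "holomorphic_several f S \<longleftrightarrow>
     (\<forall>z\<in>S. \<exists>D. (f has_derivative D) (at z) \<and> (\<forall>c v. D (c *s v) = c * D v))"

definition holomorphic_grad :: "(complex ^ 'n \<Rightarrow> complex) \<Rightarrow> complex ^ 'n \<Rightarrow> complex ^ 'n" where
  "holomorphic_grad f z = (\<chi> j. deriv (\<lambda>t. f (z + axis j t)) 0)"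

definition bloch_space :: "(complex ^ 'n \<Rightarrow> complex) set" where
  "bloch_space = {f. holomorphic_several f (ball 0 1) \<and>
     bdd_above ((\<lambda>z. norm (holomorphic_grad f z) * (1 - norm z)) ` ball 0 1)}"

(* Functions on the ball are total functions of which only the values on the ball matter. *)

definition bounded_compactly_supported :: "(complex ^ 'n \<Rightarrow> complex) \<Rightarrow> bool" where
  "bounded_compactly_supported f \<longleftrightarrow> f \<in> borel_measurable vol \<and> bounded (f ` ball 0 1) \<and>
     (\<exists>K. compact K \<and> K \<subseteq> ball 0 1 \<and> (\<forall>z\<in>ball 0 1 - K. f z = 0))"

definition weak_type_1_1 ::
  "((complex ^ 'n \<Rightarrow> complex) \<Rightarrow> complex ^ 'n \<Rightarrow> complex) \<Rightarrow> bool" where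
  "weak_type_1_1 T \<longleftrightarrow> (\<exists>C>0. \<forall>t>0. \<forall>f. bounded_compactly_supported f \<longrightarrow>
     measure vol {z \<in> ball 0 1. norm (T f z) > t} \<le> C / t * (LINT w|vol. norm (f w)))"

(* The members of sets vol are exactly the Lebesgue measurable subsets of the ball. *)

definition restricted_weak_type_1_1 ::
  "((complex ^ 'n \<Rightarrow> complex) \<Rightarrow> complex ^ 'n \<Rightarrow> complex) \<Rightarrow> bool" where
  "restricted_weak_type_1_1 T \<longleftrightarrow> (\<exists>C>0. \<forall>t>0. \<forall>A\<in>sets vol.
     measure vol {z \<in> ball 0 1. norm (T (indicator A) z) > t} \<le> C / t * measure vol A)"

end

theory Submission
  imports Defs
begin

text \<open>
  For \<open>A\<close> a small box around a point \<open>a\<close>, \<open>[cnj b, P] 1\<^sub>A z\<close> is close to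
  \<open>c\<^sub>n |A| (cnj (b z) - cnj (b a)) / (1 - herm z a)^(n+1)\<close>, uniformly for \<open>|z| \<le> 1/2\<close>. As \<open>b\<close> is bounded on
  that smaller ball, the modulus there is at least a constant times \<open>|A| |b a|\<close>, so a weak-type
  bound would force \<open>b\<close> to be bounded on the unit ball. The Bloch function \<open>Ln (1 - z\<^sub>k)\<close> is not.
\<close>

section \<open>The Hermitian form and integration over the ball\<close>

lemma norm_herm_le:
  fixes z w :: "complex ^ 'n"
  shows "norm (herm z w) \<le> norm z * norm w"
proof -
  have "norm (herm z w) \<le> (\<Sum>j\<in>UNIV. \<bar>norm (z $ j)\<bar> * \<bar>norm (w $ j)\<bar>)"
    unfolding herm_def by (rule norm_sum[THEN order_trans]) (simp add: norm_mult)
  also have "\<dots> \<le> norm z * norm w"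
    unfolding norm_vec_def by (rule L2_set_mult_ineq)
  finally show ?thesis .
qed

lemma norm_herm_less_1:
  fixes z w :: "complex ^ 'n"
  assumes "z \<in> ball 0 1" "w \<in> ball 0 1"
  shows "norm (herm z w) < 1"
proof -
  have "norm z * norm w \<le> norm z * 1"
    using assms by (intro mult_left_mono) auto
  with norm_herm_le[of z w] assms show ?thesis by simp
qed

lemma one_minus_herm_nonzero:
  fixes z w :: "complex ^ 'n"
  assumes "z \<in> ball 0 1" "w \<in> ball 0 1"
  shows "1 - herm z w \<noteq> 0"
  using norm_herm_less_1[OF assms] by auto

lemma continuous_on_herm [continuous_intros]:
  assumes "continuous_on S f" "continuous_on S g"
  shows "continuous_on S (\<lambda>x. herm (f x) (g x))"
  unfolding herm_def by (intro continuous_intros assms)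

text \<open>Passes from the Lebesgue integral in \<open>bergman_proj\<close> to the gauge integral
  over a box, where parameter continuity and norm bounds are applied later.\<close>

lemma integral_vol_cbox:
  fixes h :: "complex ^ 'n \<Rightarrow> complex"
  assumes sub: "cbox u v \<subseteq> ball 0 1" and cont: "continuous_on (cbox u v) h"
  shows "(LINT w|vol. indicator (cbox u v) w * h w) = integral (cbox u v) h"
proof -
  have "(LINT w|vol. indicator (cbox u v) w * h w)
      = (LINT w|lebesgue. indicator (ball 0 1) w *\<^sub>R (indicator (cbox u v) w * h w))"
    unfolding vol_def by (subst integral_restrict_space) auto
  also have "\<dots> = (LINT w:cbox u v|lebesgue. h w)"
    unfolding set_lebesgue_integral_def
    using sub by (intro Bochner_Integration.integral_cong) (auto simp: indicator_def)
  also have "\<dots> = integral (cbox u v) h"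
    by (intro set_lebesgue_integral_eq_integral absolutely_integrable_continuous cont)
  finally show ?thesis .
qed

lemma measure_vol:
  assumes "A \<in> sets lebesgue" "A \<subseteq> ball 0 1"
  shows "measure vol A = measure lebesgue A"
  unfolding vol_def using assms by (intro measure_restrict_space) auto

section \<open>The commutator as an integral operator on indicators of boxes\<close>

definition commutator_kernel ::
  "(complex ^ 'n \<Rightarrow> complex) \<Rightarrow> complex ^ 'n \<Rightarrow> complex ^ 'n \<Rightarrow> complex" where
  "commutator_kernel \<beta> z w = (\<beta> z - \<beta> w) / (1 - herm z w) ^ (CARD('n) + 1)"

text \<open>Joint continuity is used in two ways: for continuity of the commutator in
  \<open>z\<close>, and for uniform continuity on compact products, which makes the size of the box
  independent of \<open>z\<close>.\<close>

lemma continuous_on_commutator_kernel: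
  fixes \<beta> :: "complex ^ 'n \<Rightarrow> complex"
  assumes "continuous_on (ball 0 1) \<beta>"
  shows "continuous_on (ball 0 1 \<times> ball 0 1) (\<lambda>(z, w). commutator_kernel \<beta> z w)"
  unfolding commutator_kernel_def case_prod_beta
  by (intro continuous_intros continuous_on_compose2[OF assms])
     (auto dest: one_minus_herm_nonzero)

text \<open>The box is compact inside the ball, so both terms of the commutator are integrals of
  continuous functions over it. They exist separately and merge by linearity.\<close>

lemma commutator_proj_indicator_cbox:
  fixes \<beta> :: "complex ^ 'n \<Rightarrow> complex"
  assumes cont: "continuous_on (ball 0 1) \<beta>"
    and sub: "cbox u v \<subseteq> ball 0 1" and z: "z \<in> ball 0 1"
  shows "commutator_proj \<beta> (indicator (cbox u v)) z =
    of_real (fact CARD('n) / pi ^ CARD('n)) * integral (cbox u v) (commutator_kernel \<beta> z)"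
proof -
  let ?A = "cbox u v" and ?d = "\<lambda>w. (1 - herm z w) ^ (CARD('n) + 1)"
  have contA: "continuous_on ?A \<beta>"
    using cont sub continuous_on_subset by blast
  have nz: "1 - herm z w \<noteq> 0" if "w \<in> ?A" for w
    using one_minus_herm_nonzero[OF z] that sub by auto
  have c1: "continuous_on ?A (\<lambda>w. 1 / ?d w)" and c2: "continuous_on ?A (\<lambda>w. \<beta> w / ?d w)"
    using nz by (intro continuous_intros contA; simp)+
  have 1: "(LINT w|vol. indicator ?A w / ?d w) = integral ?A (\<lambda>w. 1 / ?d w)"
    using integral_vol_cbox[OF sub c1] by simp
  have 2: "(LINT w|vol. \<beta> w * indicator ?A w / ?d w) = integral ?A (\<lambda>w. \<beta> w / ?d w)"
    using integral_vol_cbox[OF sub c2] by (simp add: mult_ac)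
  have "integral ?A (commutator_kernel \<beta> z) = integral ?A (\<lambda>w. \<beta> z * (1 / ?d w) - \<beta> w / ?d w)"
    by (intro Henstock_Kurzweil_Integration.integral_cong)
       (simp add: commutator_kernel_def diff_divide_distrib)
  also have "\<dots> = \<beta> z * integral ?A (\<lambda>w. 1 / ?d w) - integral ?A (\<lambda>w. \<beta> w / ?d w)"
    unfolding Henstock_Kurzweil_Integration.integral_mult_right[symmetric]
    by (intro Henstock_Kurzweil_Integration.integral_diff integrable_continuous
          continuous_on_mult_left c1 c2)
  finally show ?thesis
    unfolding commutator_proj_def bergman_proj_def 1 2
    by (simp only: right_diff_distrib mult.left_commute)
qed

text \<open>Makes superlevel sets of the commutator open, hence measurable. A non-measurable set
  would have \<open>measure\<close> 0 by convention, and containing a ball would then give no lower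
  bound.\<close>

lemma continuous_on_commutator_proj_indicator_cbox:
  fixes \<beta> :: "complex ^ 'n \<Rightarrow> complex"
  assumes cont: "continuous_on (ball 0 1) \<beta>" and sub: "cbox u v \<subseteq> ball 0 1"
  shows "continuous_on (ball 0 1) (commutator_proj \<beta> (indicator (cbox u v)))"
proof -
  have "continuous_on (ball 0 1) (\<lambda>z. integral (cbox u v) (commutator_kernel \<beta> z))"
    by (rule integral_continuous_on_param, rule continuous_on_subset)
       (use continuous_on_commutator_kernel[OF cont] sub in auto)
  then have "continuous_on (ball 0 1) (\<lambda>z. of_real (fact CARD('n) / pi ^ CARD('n)) *
      integral (cbox u v) (commutator_kernel \<beta> z))"
    by (intro continuous_intros)
  then show ?thesis
    by (rule continuous_on_eq) (simp add: commutator_proj_indicator_cbox[OF assms])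
qed

section \<open>Failure of both weak-type bounds for unbounded symbols\<close>

lemma unbounded_commutator_level_set:
  fixes \<beta> :: "complex ^ 'n \<Rightarrow> complex"
  assumes cont: "continuous_on (ball 0 1) \<beta>" and unb: "\<not> bounded (\<beta> ` ball 0 1)"
    and C: "C > 0"
  obtains u v t where "cbox u v \<subseteq> ball 0 1" "t > 0"
    "C / t * measure vol (cbox u v) <
       measure vol {z \<in> ball 0 1. norm (commutator_proj \<beta> (indicator (cbox u v)) z) > t}"
proof -
  define c where "c = (fact CARD('n) / pi ^ CARD('n) :: real)"
  define m where "m = measure vol (cball (0 :: complex ^ 'n) (1/2))"
  have c: "c > 0" by (simp add: c_def)
  have m: "m > 0"
  proof -
    have "m = measure lebesgue (cball (0 :: complex ^ 'n) (1/2))"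
      unfolding m_def by (rule measure_vol) auto
    also have "\<dots> > 0"
      using content_cball_pos[of "1/2" "0 :: complex ^ 'n"] by simp
    finally show ?thesis .
  qed
  have half: "cball 0 (1/2) \<subseteq> ball (0 :: complex ^ 'n) 1" by auto
  have "bounded (\<beta> ` cball 0 (1/2))"
    by (intro compact_imp_bounded compact_continuous_image
          continuous_on_subset[OF cont half] compact_cball)
  then obtain M where M: "\<And>z. z \<in> cball 0 (1/2) \<Longrightarrow> norm (\<beta> z) \<le> M"
    unfolding bounded_iff by blast
  \<comment> \<open>With \<open>t = c * V * L / 2\<close> below, the weak-type bound becomes
    \<open>2 * C / (c * L)\<close>. It lies below \<open>m\<close> once \<open>L\<close> exceeds
    \<open>2 * C / (c * m)\<close>; the 1 makes this strict.\<close>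
  define L where "L = 2 * C / (c * m) + 1"
  have L: "L > 0" using C c m by (simp add: L_def add_pos_pos)
  \<comment> \<open>\<open>M\<close> absorbs \<open>\<beta> z\<close> on the half ball, the power of
    2 bounds the denominator of the kernel, and the extra unit pays for the variation of the kernel
    over the box.\<close>
  obtain a where a: "a \<in> ball 0 1" and ba: "norm (\<beta> a) > M + 2 ^ (CARD('n) + 1) * (L + 1)"
    using unb unfolding bounded_iff by (force simp: not_le)
  obtain e where e: "e > 0" "cball a e \<subseteq> ball 0 1"
    using a open_contains_cball open_ball by metis
  \<comment> \<open>Compactness yields a single \<open>d\<close>, and so a single box, for all
    \<open>z\<close> in the half ball.\<close>
  have "uniformly_continuous_on (cball 0 (1/2) \<times> cball a e) (\<lambda>(z, w). commutator_kernel \<beta> z w)"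
    using half e
    by (intro compact_uniformly_continuous compact_Times compact_cball
          continuous_on_subset[OF continuous_on_commutator_kernel[OF cont]]) blast
  from this[unfolded uniformly_continuous_on_def, rule_format, OF zero_less_one]
  obtain d where d: "d > 0"
    and ucont: "\<And>p q. p \<in> cball 0 (1/2) \<times> cball a e \<Longrightarrow> q \<in> cball 0 (1/2) \<times> cball a e \<Longrightarrow>
      dist q p < d \<Longrightarrow> dist (case_prod (commutator_kernel \<beta>) q) (case_prod (commutator_kernel \<beta>) p) < 1"
    by blast
  have "a \<in> ball a (min d e)" using d e(1) by simp
  \<comment> \<open>Radius \<open>d\<close> controls the kernel and \<open>e\<close> keeps the box
    in the compact set; \<open>a\<close> in the open box forces positive volume.\<close>
  then obtain u v where uv: "cbox u v \<subseteq> ball a (min d e)" "a \<in> box u v"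
    by (rule open_contains_cbox[OF open_ball])
  let ?A = "cbox u v" and ?T = "commutator_proj \<beta> (indicator (cbox u v))"
  have sub: "?A \<subseteq> ball 0 1" using uv(1) e(2) by force
  define V where "V = measure vol ?A"
  have V: "V = measure lebesgue ?A"
    unfolding V_def by (rule measure_vol) (use sub in auto)
  have Vpos: "V > 0"
    using uv(2) content_pos_lt_eq[of u v] box_ne_empty(2)[of u v] V by auto
  have lower: "norm (?T z) \<ge> c * V * L" if z: "z \<in> cball 0 (1/2)" for z
  proof -
    let ?k = "commutator_kernel \<beta> z"
    have z1: "z \<in> ball 0 1" using z half by auto
    have near: "norm (?k w - ?k a) \<le> 1" if w: "w \<in> ?A" for w
    proof -
      have "dist (z, w) (z, a) < d"
        using w uv(1) by (auto simp: dist_Pair_Pair dist_commute)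
      moreover have "w \<in> cball a e" using w uv(1) by auto
      ultimately show ?thesis
        using ucont[of "(z, a)" "(z, w)"] z e(1) by (auto simp: dist_norm)
    qed
    have "continuous_on ?A ?k"
      using continuous_on_compose2[OF continuous_on_commutator_kernel[OF cont], of ?A "\<lambda>w. (z, w)"]
        z1 sub by (force intro!: continuous_intros)
    \<comment> \<open>Freezing the kernel at \<open>a\<close> costs at most \<open>V\<close>, since
      the kernel moves by at most 1 over the box.\<close>
    then have "((\<lambda>w. ?k w - ?k a) has_integral integral ?A ?k - V *\<^sub>R ?k a) ?A"
      using has_integral_const[of "?k a" u v] V
      by (intro has_integral_diff integrable_integral integrable_continuous) auto
    then have "norm (integral ?A ?k - V *\<^sub>R ?k a) \<le> 1 * V"
      using has_integral_bound[of 1 "\<lambda>w. ?k w - ?k a" _ u v] near V by auto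
    then have "norm (integral ?A ?k) \<ge> norm (V *\<^sub>R ?k a) - V"
      using norm_triangle_ineq2[of "V *\<^sub>R ?k a" "integral ?A ?k"] by (simp add: norm_minus_commute)
    then have int: "norm (integral ?A ?k) \<ge> V * (norm (?k a) - 1)"
      using Vpos by (simp add: algebra_simps)
    have "norm (1 - herm z a) \<le> 2"
      using norm_triangle_ineq4[of 1 "herm z a"] norm_herm_less_1[OF z1 a] by simp
    then have den: "norm (1 - herm z a) ^ (CARD('n) + 1) \<le> 2 ^ (CARD('n) + 1)"
      by (intro power_mono) auto
    have num: "norm (\<beta> z - \<beta> a) \<ge> 2 ^ (CARD('n) + 1) * (L + 1)"
      using ba M[OF z] norm_triangle_ineq2[of "\<beta> a" "\<beta> z"] by (simp add: norm_minus_commute)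
    have "(L + 1) * norm (1 - herm z a) ^ (CARD('n) + 1) \<le> (L + 1) * 2 ^ (CARD('n) + 1)"
      using den L by (intro mult_left_mono) auto
    also have "\<dots> \<le> norm (\<beta> z - \<beta> a)" using num by (simp add: mult.commute)
    finally have "norm (?k a) \<ge> L + 1"
      using one_minus_herm_nonzero[OF z1 a]
      by (simp add: commutator_kernel_def norm_divide norm_power norm_mult pos_le_divide_eq)
    then have "V * L \<le> V * (norm (?k a) - 1)"
      using Vpos by (intro mult_left_mono) auto
    with int have "V * L \<le> norm (integral ?A ?k)" by linarith
    then have "c * (V * L) \<le> c * norm (integral ?A ?k)"
      using c by (intro mult_left_mono) auto
    also have "\<dots> = norm (?T z)"
      unfolding commutator_proj_indicator_cbox[OF cont sub z1] c_def[symmetric] norm_mult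
      using c by simp
    finally show ?thesis by (simp add: mult_ac)
  qed
  \<comment> \<open>Half the lower bound, because the level set is defined by a strict
    inequality.\<close>
  define t where "t = c * V * L / 2"
  have t: "t > 0" using c Vpos L by (simp add: t_def)
  define S where "S = {z \<in> ball 0 1. norm (?T z) > t}"
  have "open S"
    using continuous_open_preimage[of "ball 0 1" "\<lambda>z. norm (?T z)" "{t<..}"]
      continuous_on_commutator_proj_indicator_cbox[OF cont sub]
    by (auto simp: S_def vimage_def Int_def conj_commute intro: continuous_on_norm)
  have Ssub: "S \<subseteq> ball 0 1" by (auto simp: S_def)
  have S: "S \<in> lmeasurable"
    using bounded_subset[OF bounded_ball Ssub] \<open>open S\<close> by (rule lmeasurable_open)
  have "c * V * L > t" using t unfolding t_def by linarith
  then have "cball 0 (1/2) \<subseteq> S"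
    using lower half by (force simp: S_def)
  then have "measure lebesgue (cball (0 :: complex ^ 'n) (1/2)) \<le> measure lebesgue S"
    by (rule measure_mono_fmeasurable) (use S in auto)
  then have "m \<le> measure lebesgue S"
    unfolding m_def by (subst measure_vol) (use half in auto)
  also have "\<dots> = measure vol S"
    using S Ssub by (intro measure_vol[symmetric]) auto
  finally have mS: "m \<le> measure vol S" .
  \<comment> \<open>The volume of the box cancels, while the level set keeps measure at least
    \<open>m\<close> however small the box is.\<close>
  have "C / t * V = 2 * C / (c * L)"
    using Vpos c L by (simp add: t_def field_simps)
  also have "\<dots> < m"
  proof -
    have "c * m * L = 2 * C + c * m" using c m by (simp add: L_def field_simps)
    then have "2 * C < m * (c * L)" using mult_pos_pos[OF c m] by (simp add: mult_ac)
    then show ?thesis using c L by (simp add: pos_divide_less_eq)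
  qed
  also note mS
  finally show ?thesis
    using that[OF sub t] by (simp add: S_def V_def)
qed

text \<open>A compact box in the ball is a measurable set whose indicator is also bounded and
  compactly supported, with integral equal to its measure. The same box therefore refutes any given
  constant in either estimate.\<close>

lemma not_weak_types_if_unbounded:
  fixes \<beta> :: "complex ^ 'n \<Rightarrow> complex"
  assumes "continuous_on (ball 0 1) \<beta>" "\<not> bounded (\<beta> ` ball 0 1)"
  shows "\<not> weak_type_1_1 (commutator_proj \<beta>)"
    and "\<not> restricted_weak_type_1_1 (commutator_proj \<beta>)"
proof -
  show "\<not> restricted_weak_type_1_1 (commutator_proj \<beta>)"
  proof
    assume "restricted_weak_type_1_1 (commutator_proj \<beta>)"
    then obtain C where C: "C > 0" and bound: "\<And>t A. t > 0 \<Longrightarrow> A \<in> sets vol \<Longrightarrow>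
        measure vol {z \<in> ball 0 1. norm (commutator_proj \<beta> (indicator A) z) > t}
          \<le> C / t * measure vol A"
      unfolding restricted_weak_type_1_1_def by blast
    obtain u v t where uv: "cbox u v \<subseteq> ball 0 1" "t > 0"
      "C / t * measure vol (cbox u v) <
         measure vol {z \<in> ball 0 1. norm (commutator_proj \<beta> (indicator (cbox u v)) z) > t}"
      using unbounded_commutator_level_set[OF assms C] by blast
    have "cbox u v \<in> sets vol"
      using uv(1) by (simp add: vol_def sets_restrict_space_iff)
    with bound[OF uv(2)] uv(3) show False by (meson not_le)
  qed
  show "\<not> weak_type_1_1 (commutator_proj \<beta>)"
  proof
    assume "weak_type_1_1 (commutator_proj \<beta>)"
    then obtain C where C: "C > 0" and bound: "\<And>t f. t > 0 \<Longrightarrow> bounded_compactly_supported f \<Longrightarrow>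
        measure vol {z \<in> ball 0 1. norm (commutator_proj \<beta> f z) > t}
          \<le> C / t * (LINT w|vol. norm (f w))"
      unfolding weak_type_1_1_def by blast
    obtain u v t where uv: "cbox u v \<subseteq> ball 0 1" "t > 0"
      "C / t * measure vol (cbox u v) <
         measure vol {z \<in> ball 0 1. norm (commutator_proj \<beta> (indicator (cbox u v)) z) > t}"
      using unbounded_commutator_level_set[OF assms C] by blast
    let ?f = "indicator (cbox u v) :: complex ^ 'n \<Rightarrow> complex"
    have sets: "cbox u v \<in> sets vol"
      using uv(1) by (simp add: vol_def sets_restrict_space_iff)
    have "bounded (?f ` ball 0 1)"
      by (rule bounded_subset[of "{0, 1}"]) (auto simp: indicator_def)
    then have "bounded_compactly_supported ?f"
      unfolding bounded_compactly_supported_def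
      using uv(1) sets by (auto intro!: exI[of _ "cbox u v"] compact_cbox)
    moreover have "(LINT w|vol. norm (?f w)) = measure vol (cbox u v)"
    proof -
      have "(LINT w|vol. norm (?f w)) = (LINT w|vol. indicator (cbox u v) w)"
        by (intro Bochner_Integration.integral_cong) (auto simp: indicator_def)
      also have "\<dots> = measure vol (cbox u v)"
        using sets by (simp add: sets.Int_space_eq1 Int_absorb2 sets.sets_into_space)
      finally show ?thesis .
    qed
    ultimately show False
      using bound[OF uv(2), of ?f] uv(3) by simp
  qed
qed

section \<open>An unbounded Bloch function\<close>

lemma norm_axis: "norm (axis k x) = norm x" for x :: "'a :: real_inner"
  by (simp add: norm_eq_sqrt_inner inner_axis_axis)

text \<open>On the closed ball the only singularity is the boundary point \<open>axis k 1\<close>.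
  It is logarithmic, so the gradient grows no faster than the Bloch condition allows.\<close>

definition log_bloch :: "'n \<Rightarrow> complex ^ 'n \<Rightarrow> complex" where
  "log_bloch k z = Ln (1 - z $ k)"

text \<open>Keeps the argument of \<open>Ln\<close> off the branch cut.\<close>

lemma one_minus_component_Re_pos:
  fixes z :: "complex ^ 'n"
  assumes "z \<in> ball 0 1"
  shows "Re (1 - z $ k) > 0"
  using assms Finite_Cartesian_Product.norm_nth_le[of z k]
    complex_Re_le_cmod[of "z $ k"] by simp

lemma log_bloch_has_derivative:
  fixes z :: "complex ^ 'n"
  assumes "z \<in> ball 0 1"
  shows "(log_bloch k has_derivative (\<lambda>v. - (v $ k) / (1 - z $ k))) (at z)"
proof -
  have "1 - z $ k \<notin> \<real>\<^sub>\<le>\<^sub>0"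
    using one_minus_component_Re_pos[OF assms, of k] complex_nonpos_Reals_iff by force
  then have Ln: "(Ln has_derivative (*) (inverse (1 - z $ k))) (at (1 - z $ k))"
    unfolding has_field_derivative_def[symmetric] by (rule has_field_derivative_Ln)
  have "((\<lambda>x. 1 - x $ k) has_derivative (\<lambda>v. - (v $ k))) (at z)"
    by (auto intro!: derivative_eq_intros bounded_linear.has_derivative[OF bounded_linear_vec_nth])
  from has_derivative_compose[OF this Ln] show ?thesis
    unfolding log_bloch_def[abs_def] by (simp add: divide_inverse mult.commute)
qed

lemma norm_holomorphic_grad_log_bloch:
  fixes z :: "complex ^ 'n"
  assumes z: "z \<in> ball 0 1"
  shows "norm (holomorphic_grad (log_bloch k) z) = 1 / norm (1 - z $ k)"
proof -
  \<comment> \<open>Only coordinate \<open>k\<close> enters the function, so the gradient is a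
    multiple of one basis vector.\<close>
  have "deriv (\<lambda>t. log_bloch k (z + axis j t)) 0 = axis k (- 1 / (1 - z $ k)) $ j" for j
  proof (cases "j = k")
    case True
    have "1 - z $ k \<notin> \<real>\<^sub>\<le>\<^sub>0"
      using one_minus_component_Re_pos[OF z, of k] complex_nonpos_Reals_iff by force
    then have "((\<lambda>t. Ln (1 - (z $ k + t))) has_field_derivative - 1 / (1 - z $ k)) (at 0)"
      by (auto intro!: derivative_eq_intros simp: inverse_eq_divide)
    with True show ?thesis
      by (auto simp: log_bloch_def axis_def intro: DERIV_imp_deriv)
  next
    case False
    then show ?thesis by (simp add: log_bloch_def axis_def)
  qed
  then have "holomorphic_grad (log_bloch k) z = axis k (- 1 / (1 - z $ k))"
    by (simp add: holomorphic_grad_def vec_eq_iff)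
  then show ?thesis by (simp add: norm_axis norm_divide)
qed

lemma log_bloch_in_bloch_space: "log_bloch k \<in> bloch_space"
proof -
  have "holomorphic_several (log_bloch k) (ball 0 1)"
    unfolding holomorphic_several_def
    by (intro ballI exI conjI, erule log_bloch_has_derivative) auto
  moreover have "norm (holomorphic_grad (log_bloch k) z) * (1 - norm z) \<le> 1"
    if z: "z \<in> ball 0 1" for z
  proof -
    \<comment> \<open>A coordinate is no larger than the whole vector, so the gradient is at most
      \<open>1 / (1 - norm z)\<close>.\<close>
    have "1 - norm z \<le> norm (1 - z $ k)"
      using norm_triangle_ineq2[of 1 "z $ k"] Finite_Cartesian_Product.norm_nth_le[of z k] by simp
    then show ?thesis
      unfolding norm_holomorphic_grad_log_bloch[OF z] using z by (simp add: divide_le_eq)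
  qed
  ultimately show ?thesis
    unfolding bloch_space_def by (auto intro!: bdd_aboveI2)
qed

lemma unbounded_log_bloch: "\<not> bounded (log_bloch k ` ball 0 1)"
proof
  assume "bounded (log_bloch k ` ball 0 1)"
  then obtain B where B: "\<And>z. z \<in> ball 0 1 \<Longrightarrow> norm (log_bloch k z) \<le> B"
    unfolding bounded_iff by blast
  \<comment> \<open>Chosen so that \<open>Ln s\<close> has modulus \<open>\<bar>B\<bar> + 1\<close>,
    which exceeds \<open>B\<close>; the absolute value ensures \<open>s < 1\<close> for either sign
    of \<open>B\<close>.\<close>
  define s where "s = exp (- (\<bar>B\<bar> + 1))"
  have s: "0 < s" "s < 1" by (auto simp: s_def)
  have "axis k (of_real (1 - s)) \<in> ball (0 :: complex ^ 'a) 1"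
    using s by (simp add: norm_axis del: of_real_diff)
  from B[OF this] have "norm (Ln (of_real s)) \<le> B"
    by (simp add: log_bloch_def axis_def)
  then show False
    using s by (simp add: Ln_of_real norm_of_real) (simp add: s_def)
qed

theorem theorem1:
  "\<exists>b \<in> (bloch_space :: (complex ^ 'n \<Rightarrow> complex) set).
     \<not> weak_type_1_1 (commutator_proj (\<lambda>z. cnj (b z))) \<and>
     \<not> restricted_weak_type_1_1 (commutator_proj (\<lambda>z. cnj (b z)))"
proof (intro bexI conjI)
  \<comment> \<open>Any coordinate will do; \<open>undefined\<close> is just some element of the
    index type.\<close>
  let ?b = "log_bloch undefined :: complex ^ 'n \<Rightarrow> complex"
  show "?b \<in> bloch_space" by (rule log_bloch_in_bloch_space)
  have "continuous_on (ball 0 1) ?b"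
    by (meson log_bloch_has_derivative continuous_at_imp_continuous_on has_derivative_continuous)
  \<comment> \<open>The criterion asks only for continuity and unboundedness, both preserved by
    conjugation.\<close>
  then have cont: "continuous_on (ball 0 1) (\<lambda>z. cnj (?b z))"
    by (intro continuous_intros)
  have unb: "\<not> bounded ((\<lambda>z. cnj (?b z)) ` ball 0 1)"
    using unbounded_log_bloch by (simp add: bounded_iff)
  show "\<not> weak_type_1_1 (commutator_proj (\<lambda>z. cnj (?b z)))"
    and "\<not> restricted_weak_type_1_1 (commutator_proj (\<lambda>z. cnj (?b z)))"
    using not_weak_types_if_unbounded[OF cont unb] .
qed

end
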